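(* Let $(G,P)$ be a quasi-lattice ordered group and $X$ a compactly aligned product system over $P$ of right Hilbert $A$--$A$-bimodules. Let $\sigma^N$ be the dynamics on $\mathcal{NT}(X)$ arising from an injective homomorphism $N:G\to(0,\infty)$. Let $0<\beta<\infty$. If $\omega$ is a KMS$_\beta$ state of $(\mathcal{NT}(X),\sigma^N)$, then $\omega$ factors through $\Phi^\delta$ to give a tracial state $\phi$ on the core $\mathcal F$ (that is, $\phi:=\omega|_{\mathcal F}$ is a tracial state of $\mathcal F$ and $\omega=\phi\circ\Phi^\delta$) that satisfies the scaling identity $$\phi\bigl(i_s(\xi)\,y\,i_r(\eta)^*\bigr)=\delta_{s,r}\,N(s)^{-\beta}\,\phi\bigl(y\, i_e(\langle\eta,\xi\rangle_s)\bigr)$$ for all $\xi\in X_s$, $\eta\in X_r$, $s,r\in P$ and $y\in\mathcal F$. (For $s\ne r$ the left-hand side is read as $\omega(i_s(\xi)yi_r(\eta)^* )=\phi\circ\Phi^\delta(i_s(\xi)yi_r(\eta)^* )$ and the right-hand side is $0$.)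
   Context: $A$ is a unital $C^*$-algebra. A right Hilbert $A$--$A$-bimodule is a right Hilbert $A$-module $Y$ (inner product $A$-valued, conjugate-linear in the first variable) with a $*$-homomorphism $\varphi:A\to\mathcal L(Y)$ (adjointable operators) giving the left action. $\theta_{\xi,\eta}(\zeta)=\xi\cdot\langle\eta,\zeta\rangle$ and $\mathcal K(Y)=\overline{\mathrm{span}}\{\theta_{\xi,\eta}\}$. The balanced tensor product $X\otimes_A Y$ has inner product $\langle\xi_1\otimes\eta_1,\xi_2\otimes\eta_2\rangle=\langle\langle\xi_2,\xi_1\rangle\cdot\eta_1,\eta_2\rangle$ and left action $a\mapsto\varphi(a)\otimes I$. $(G,P)$ is a quasi-lattice ordered group if $G$ is a discrete group, $P\subseteq G$ is a subsemigroup with $P\cap P^{-1}=\{e\}$, and, for the order $s\preceq r\Leftrightarrow s^{-1}r\in P$, any two elements $s,r\in G$ with a common upper bound in $P$ have a least upper bound $s\vee r\in P$ (written $s\vee r<\infty$; otherwise $s\vee r=\infty$). A product system over $P$ is $X=\bigsqcup_{s\in P}X_s$ where each $X_s$ is a right Hilbert $A$--$A$-bimodule (inner product $\langle\cdot,\cdot\rangle_s$, left action $\varphi_s$), $X_e={}_AA_A$ with $\langle a,b\rangle=a^*b$, and $X$ is a semigroup with $X_sX_r\subseteq X_{sr}$, such that for $s,r\neq e$ the product extends to an isomorphism $F^{s,r}:X_s\otimes_AX_r\to X_{sr}$ of right Hilbert $A$--$A$-bimodules, while products with elements of $X_e=A$ are given by the bimodule actions. For $S\in\mathcal L(X_s)$,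 $i_s^{sr}(S)=F^{s,r}(S\otimes_AI_r)(F^{s,r})^*\in\mathcal L(X_{sr})$; $i_e^r=\varphi_r$, $i_s^s=\mathrm{id}$. $X$ is compactly aligned if $i_s^{s\vee r}(S)i_r^{s\vee r}(T)\in\mathcal K(X_{s\vee r})$ whenever $s\vee r<\infty$, $S\in\mathcal K(X_s)$, $T\in\mathcal K(X_r)$. A Toeplitz representation $\psi:X\to C$ in a $C^*$-algebra $C$: $\psi_s=\psi|_{X_s}$ linear, $\psi_e$ a $*$-homomorphism, $\psi_s(\xi)\psi_r(\eta)=\psi_{sr}(\xi\eta)$, and $\psi_s(\xi)^*\psi_s(\eta)=\psi_e(\langle\xi,\eta\rangle_s)$. It induces $*$-homomorphisms $\psi^{(s)}:\mathcal K(X_s)\to C$, $\psi^{(s)}(\theta_{\xi,\eta})=\psi_s(\xi)\psi_s(\eta)^*$. It is Nica covariant if $\psi^{(s)}(S)\psi^{(r)}(T)$ equals $\psi^{(s\vee r)}(i_s^{s\vee r}(S)i_r^{s\vee r}(T))$ when $s\vee r<\infty$ and $0$ otherwise. $\mathcal{NT}(X)$ is the $C^*$-algebra generated by a universal Nica covariant Toeplitz representation $i_X$, with $i_s=i_X|_{X_s}$; it is the closed span of the elements $i_s(\xi)i_r(\eta)^*$. The core $\mathcal F$ is the closed span of the elements $i_s(\xi)i_s(\eta)^*$, $\xi,\eta\in X_s$, $s\in P$. There is a conditional expectation $\Phi^\delta:\mathcal{NT}(X)\to\mathcal F$ with $\Phi^\delta(i_s(\xi)i_r(\eta)^* )=\delta_{s,r}\,i_s(\xi)i_s(\eta)^*$.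 For a homomorphism $N:G\to(0,\infty)$ (multiplicative), $\sigma^N:\mathbb R\to\mathrm{Aut}(\mathcal{NT}(X))$ is the dynamics with $\sigma^N_t(i_e(a))=i_e(a)$, $\sigma^N_t(i_s(\xi))=N(s)^{it}i_s(\xi)$. An element $c$ is $\sigma$-analytic if $t\mapsto\sigma_t(c)$ extends to an entire function. For $0<\beta<\infty$, a KMS$_\beta$ state of $(C,\sigma)$ is a state $\omega$ with $\omega(cd)=\omega(d\sigma_{i\beta}(c))$ for all $\sigma$-analytic $c,d$. *)

theory Defs
  imports "HOL-Analysis.Analysis" "HOL-Algebra.Module"
begin

text \<open>
  Algebras and modules are records with explicit carriers, extending the (module) records of
  HOL-Algebra: a complex vector space is a module over \<open>complex_field\<close>. The fields \<open>mult\<close> and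
  \<open>one\<close>, which HOL-Algebra puts into every module record, carry no meaning for Hilbert modules,
  and \<open>one\<close> carries no meaning for algebras that are not assumed to be unital.
\<close>

section \<open>Normed complex vector spaces\<close>

definition complex_field :: "complex ring" where
  "complex_field = \<lparr>carrier = UNIV, mult = (*), one = 1, zero = 0, add = (+)\<rparr>"

definition lin_span :: "(complex, 'v, 'm) module_scheme \<Rightarrow> 'v set \<Rightarrow> 'v set" where
  "lin_span V S = \<Inter>{W. submodule W complex_field V \<and> S \<subseteq> W}"

definition linear_map ::
  "(complex, 'v, 'm) module_scheme \<Rightarrow> (complex, 'w, 'n) module_scheme \<Rightarrow> ('v \<Rightarrow> 'w) \<Rightarrow> bool" where
  "linear_map V W f \<longleftrightarrow> f \<in> carrier V \<rightarrow> carrier W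
     \<and> (\<forall>x\<in>carrier V. \<forall>y\<in>carrier V. f (x \<oplus>\<^bsub>V\<^esub> y) = f x \<oplus>\<^bsub>W\<^esub> f y)
     \<and> (\<forall>c. \<forall>x\<in>carrier V. f (c \<odot>\<^bsub>V\<^esub> x) = c \<odot>\<^bsub>W\<^esub> f x)"

(* Metric_space asks for nonnegativity and symmetry on the whole type, hence the value 0 off the
   carrier. *)
definition norm_dist :: "('v, 'm) ring_scheme \<Rightarrow> ('v \<Rightarrow> real) \<Rightarrow> 'v \<Rightarrow> 'v \<Rightarrow> real" where
  "norm_dist V n x y = (if x \<in> carrier V \<and> y \<in> carrier V then n (x \<ominus>\<^bsub>V\<^esub> y) else 0)"

definition norm_topology :: "('v, 'm) ring_scheme \<Rightarrow> ('v \<Rightarrow> real) \<Rightarrow> 'v topology" where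
  "norm_topology V n = Metric_space.mtopology (carrier V) (norm_dist V n)"

definition norm_complete :: "('v, 'm) ring_scheme \<Rightarrow> ('v \<Rightarrow> real) \<Rightarrow> bool" where
  "norm_complete V n \<longleftrightarrow> Metric_space.mcomplete (carrier V) (norm_dist V n)"


section \<open>C*-algebras\<close>

record 'a star_alg = "(complex, 'a) module" +
  star :: "'a \<Rightarrow> 'a"
  nrm :: "'a \<Rightarrow> real"

locale cstar_algebra =
  fixes C :: "('a, 'm) star_alg_scheme" (structure)
  assumes vector_space: "Module.module complex_field C"
    and mult_closed: "\<lbrakk>x \<in> carrier C; y \<in> carrier C\<rbrakk> \<Longrightarrow> x \<otimes> y \<in> carrier C"
    and mult_assoc: "\<lbrakk>x \<in> carrier C; y \<in> carrier C; z \<in> carrier C\<rbrakk>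
      \<Longrightarrow> (x \<otimes> y) \<otimes> z = x \<otimes> (y \<otimes> z)"
    and distr_r: "\<lbrakk>x \<in> carrier C; y \<in> carrier C; z \<in> carrier C\<rbrakk>
      \<Longrightarrow> (x \<oplus> y) \<otimes> z = (x \<otimes> z) \<oplus> (y \<otimes> z)"
    and distr_l: "\<lbrakk>x \<in> carrier C; y \<in> carrier C; z \<in> carrier C\<rbrakk>
      \<Longrightarrow> z \<otimes> (x \<oplus> y) = (z \<otimes> x) \<oplus> (z \<otimes> y)"
    and smult_mult_l: "\<lbrakk>x \<in> carrier C; y \<in> carrier C\<rbrakk> \<Longrightarrow> (c \<odot> x) \<otimes> y = c \<odot> (x \<otimes> y)"
    and smult_mult_r: "\<lbrakk>x \<in> carrier C; y \<in> carrier C\<rbrakk> \<Longrightarrow> x \<otimes> (c \<odot> y) = c \<odot> (x \<otimes> y)"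
    and star_closed: "x \<in> carrier C \<Longrightarrow> star C x \<in> carrier C"
    and star_star: "x \<in> carrier C \<Longrightarrow> star C (star C x) = x"
    and star_add: "\<lbrakk>x \<in> carrier C; y \<in> carrier C\<rbrakk> \<Longrightarrow> star C (x \<oplus> y) = star C x \<oplus> star C y"
    and star_smult: "x \<in> carrier C \<Longrightarrow> star C (c \<odot> x) = cnj c \<odot> star C x"
    and star_mult: "\<lbrakk>x \<in> carrier C; y \<in> carrier C\<rbrakk> \<Longrightarrow> star C (x \<otimes> y) = star C y \<otimes> star C x"
    and nrm_nonneg: "x \<in> carrier C \<Longrightarrow> 0 \<le> nrm C x"
    and nrm_eq_0: "x \<in> carrier C \<Longrightarrow> nrm C x = 0 \<longleftrightarrow> x = \<zero>"
    and nrm_triangle: "\<lbrakk>x \<in> carrier C; y \<in> carrier C\<rbrakk> \<Longrightarrow> nrm C (x \<oplus> y) \<le> nrm C x + nrm C y"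
    and nrm_smult: "x \<in> carrier C \<Longrightarrow> nrm C (c \<odot> x) = cmod c * nrm C x"
    and nrm_mult: "\<lbrakk>x \<in> carrier C; y \<in> carrier C\<rbrakk> \<Longrightarrow> nrm C (x \<otimes> y) \<le> nrm C x * nrm C y"
    and cstar_identity: "x \<in> carrier C \<Longrightarrow> nrm C (star C x \<otimes> x) = (nrm C x)\<^sup>2"
    and complete: "norm_complete C (nrm C)"

definition unital :: "('a, 'm) star_alg_scheme \<Rightarrow> bool" where
  "unital C \<longleftrightarrow> \<one>\<^bsub>C\<^esub> \<in> carrier C \<and> (\<forall>x\<in>carrier C. \<one>\<^bsub>C\<^esub> \<otimes>\<^bsub>C\<^esub> x = x \<and> x \<otimes>\<^bsub>C\<^esub> \<one>\<^bsub>C\<^esub> = x)"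

definition positive_in :: "('a, 'm) star_alg_scheme \<Rightarrow> 'a \<Rightarrow> bool" where
  "positive_in C x \<longleftrightarrow> (\<exists>b\<in>carrier C. x = star C b \<otimes>\<^bsub>C\<^esub> b)"

definition star_hom ::
  "('a, 'm) star_alg_scheme \<Rightarrow> ('b, 'n) star_alg_scheme \<Rightarrow> ('a \<Rightarrow> 'b) \<Rightarrow> bool" where
  "star_hom C D h \<longleftrightarrow> linear_map C D h
     \<and> (\<forall>x\<in>carrier C. \<forall>y\<in>carrier C. h (x \<otimes>\<^bsub>C\<^esub> y) = h x \<otimes>\<^bsub>D\<^esub> h y)
     \<and> (\<forall>x\<in>carrier C. h (star C x) = star D (h x))"

definition closed_span :: "('a, 'm) star_alg_scheme \<Rightarrow> 'a set \<Rightarrow> 'a set" where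
  "closed_span C S = norm_topology C (nrm C) closure_of lin_span C S"

definition cstar_subalgebra :: "('a, 'm) star_alg_scheme \<Rightarrow> 'a set \<Rightarrow> bool" where
  "cstar_subalgebra C D \<longleftrightarrow> submodule D complex_field C
     \<and> (\<forall>x\<in>D. \<forall>y\<in>D. x \<otimes>\<^bsub>C\<^esub> y \<in> D) \<and> (\<forall>x\<in>D. star C x \<in> D)
     \<and> closedin (norm_topology C (nrm C)) D"

definition state :: "('a, 'm) star_alg_scheme \<Rightarrow> ('a \<Rightarrow> complex) \<Rightarrow> bool" where
  "state C \<omega> \<longleftrightarrow>
     (\<forall>x\<in>carrier C. \<forall>y\<in>carrier C. \<omega> (x \<oplus>\<^bsub>C\<^esub> y) = \<omega> x + \<omega> y)
     \<and> (\<forall>c. \<forall>x\<in>carrier C. \<omega> (c \<odot>\<^bsub>C\<^esub> x) = c * \<omega> x)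
     \<and> (\<forall>x\<in>carrier C. \<omega> (star C x \<otimes>\<^bsub>C\<^esub> x) \<in> \<real>\<^sub>\<ge>\<^sub>0)
     \<and> bdd_above ((\<lambda>x. cmod (\<omega> x)) ` {x \<in> carrier C. nrm C x \<le> 1})
     \<and> (SUP x\<in>{x \<in> carrier C. nrm C x \<le> 1}. cmod (\<omega> x)) = 1"

definition tracial_state :: "('a, 'm) star_alg_scheme \<Rightarrow> ('a \<Rightarrow> complex) \<Rightarrow> bool" where
  "tracial_state C \<phi> \<longleftrightarrow> state C \<phi>
     \<and> (\<forall>x\<in>carrier C. \<forall>y\<in>carrier C. \<phi> (x \<otimes>\<^bsub>C\<^esub> y) = \<phi> (y \<otimes>\<^bsub>C\<^esub> x))"

definition conditional_expectation ::
  "('a, 'm) star_alg_scheme \<Rightarrow> 'a set \<Rightarrow> ('a \<Rightarrow> 'a) \<Rightarrow> bool" where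
  "conditional_expectation C D E \<longleftrightarrow> cstar_subalgebra C D
     \<and> linear_map C (C\<lparr>carrier := D\<rparr>) E
     \<and> (\<forall>d\<in>D. E d = d)
     \<and> (\<forall>x\<in>carrier C. nrm C (E x) \<le> nrm C x)
     \<and> (\<forall>x\<in>carrier C. positive_in (C\<lparr>carrier := D\<rparr>) (E (star C x \<otimes>\<^bsub>C\<^esub> x)))
     \<and> (\<forall>d\<in>D. \<forall>x\<in>carrier C. E (d \<otimes>\<^bsub>C\<^esub> x) = d \<otimes>\<^bsub>C\<^esub> E x \<and> E (x \<otimes>\<^bsub>C\<^esub> d) = E x \<otimes>\<^bsub>C\<^esub> d)"


section \<open>Dynamics and KMS states\<close>

(* The last clause is automatic for C*-algebras. *)
definition star_automorphism :: "('a, 'm) star_alg_scheme \<Rightarrow> ('a \<Rightarrow> 'a) \<Rightarrow> bool" where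
  "star_automorphism C h \<longleftrightarrow> star_hom C C h \<and> bij_betw h (carrier C) (carrier C)
     \<and> (\<forall>x\<in>carrier C. nrm C (h x) = nrm C x)"

definition dynamics :: "('a, 'm) star_alg_scheme \<Rightarrow> (real \<Rightarrow> 'a \<Rightarrow> 'a) \<Rightarrow> bool" where
  "dynamics C \<sigma> \<longleftrightarrow>
     (\<forall>t. star_automorphism C (\<sigma> t))
     \<and> (\<forall>x\<in>carrier C. \<sigma> 0 x = x)
     \<and> (\<forall>s t. \<forall>x\<in>carrier C. \<sigma> (s + t) x = \<sigma> s (\<sigma> t x))
     \<and> (\<forall>x\<in>carrier C. continuous_map euclideanreal (norm_topology C (nrm C)) (\<lambda>t. \<sigma> t x))"

definition entire :: "('a, 'm) star_alg_scheme \<Rightarrow> (complex \<Rightarrow> 'a) \<Rightarrow> bool" where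
  "entire C f \<longleftrightarrow> (\<forall>z. f z \<in> carrier C)
     \<and> (\<forall>z. \<exists>D\<in>carrier C.
          ((\<lambda>w. nrm C ((1 / (w - z)) \<odot>\<^bsub>C\<^esub> (f w \<ominus>\<^bsub>C\<^esub> f z) \<ominus>\<^bsub>C\<^esub> D)) \<longlongrightarrow> 0) (at z))"

definition entire_extension ::
  "('a, 'm) star_alg_scheme \<Rightarrow> (real \<Rightarrow> 'a \<Rightarrow> 'a) \<Rightarrow> 'a \<Rightarrow> (complex \<Rightarrow> 'a) \<Rightarrow> bool" where
  "entire_extension C \<sigma> c f \<longleftrightarrow> entire C f \<and> (\<forall>t. f (complex_of_real t) = \<sigma> t c)"

definition analytic_elements ::
  "('a, 'm) star_alg_scheme \<Rightarrow> (real \<Rightarrow> 'a \<Rightarrow> 'a) \<Rightarrow> 'a set" where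
  "analytic_elements C \<sigma> = {c \<in> carrier C. \<exists>f. entire_extension C \<sigma> c f}"

(* The entire extension f of t \<mapsto> \<sigma>_t(c) is unique, so f (\<i> * \<beta>) is \<sigma>_{i\<beta>}(c). *)
definition KMS_state ::
  "('a, 'm) star_alg_scheme \<Rightarrow> (real \<Rightarrow> 'a \<Rightarrow> 'a) \<Rightarrow> real \<Rightarrow> ('a \<Rightarrow> complex) \<Rightarrow> bool" where
  "KMS_state C \<sigma> \<beta> \<omega> \<longleftrightarrow> state C \<omega>
     \<and> (\<forall>c\<in>analytic_elements C \<sigma>. \<forall>d\<in>analytic_elements C \<sigma>. \<forall>f.
          entire_extension C \<sigma> c f
            \<longrightarrow> \<omega> (c \<otimes>\<^bsub>C\<^esub> d) = \<omega> (d \<otimes>\<^bsub>C\<^esub> f (\<i> * complex_of_real \<beta>)))"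


section \<open>Hilbert bimodules\<close>

record ('a, 'x) bimod = "(complex, 'x) module" +
  ract :: "'x \<Rightarrow> 'a \<Rightarrow> 'x"
  lact :: "'a \<Rightarrow> 'x \<Rightarrow> 'x"
  ip :: "'x \<Rightarrow> 'x \<Rightarrow> 'a"

definition hnorm :: "('a, 'm) star_alg_scheme \<Rightarrow> ('a, 'x, 'n) bimod_scheme \<Rightarrow> 'x \<Rightarrow> real" where
  "hnorm A Y \<xi> = sqrt (nrm A (ip Y \<xi> \<xi>))"

locale right_hilbert_module =
  fixes A :: "('a, 'm) star_alg_scheme" and Y :: "('a, 'x, 'n) bimod_scheme"
  assumes coeff: "cstar_algebra A"
    and vector_space: "Module.module complex_field Y"
    and ract_closed: "\<lbrakk>\<xi> \<in> carrier Y; a \<in> carrier A\<rbrakk> \<Longrightarrow> ract Y \<xi> a \<in> carrier Y"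
    and ract_add_l: "\<lbrakk>\<xi> \<in> carrier Y; \<eta> \<in> carrier Y; a \<in> carrier A\<rbrakk>
      \<Longrightarrow> ract Y (\<xi> \<oplus>\<^bsub>Y\<^esub> \<eta>) a = ract Y \<xi> a \<oplus>\<^bsub>Y\<^esub> ract Y \<eta> a"
    and ract_add_r: "\<lbrakk>\<xi> \<in> carrier Y; a \<in> carrier A; b \<in> carrier A\<rbrakk>
      \<Longrightarrow> ract Y \<xi> (a \<oplus>\<^bsub>A\<^esub> b) = ract Y \<xi> a \<oplus>\<^bsub>Y\<^esub> ract Y \<xi> b"
    and ract_smult_l: "\<lbrakk>\<xi> \<in> carrier Y; a \<in> carrier A\<rbrakk>
      \<Longrightarrow> ract Y (c \<odot>\<^bsub>Y\<^esub> \<xi>) a = c \<odot>\<^bsub>Y\<^esub> ract Y \<xi> a"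
    and ract_smult_r: "\<lbrakk>\<xi> \<in> carrier Y; a \<in> carrier A\<rbrakk>
      \<Longrightarrow> ract Y \<xi> (c \<odot>\<^bsub>A\<^esub> a) = c \<odot>\<^bsub>Y\<^esub> ract Y \<xi> a"
    and ract_mult: "\<lbrakk>\<xi> \<in> carrier Y; a \<in> carrier A; b \<in> carrier A\<rbrakk>
      \<Longrightarrow> ract Y \<xi> (a \<otimes>\<^bsub>A\<^esub> b) = ract Y (ract Y \<xi> a) b"
    and ip_closed: "\<lbrakk>\<xi> \<in> carrier Y; \<eta> \<in> carrier Y\<rbrakk> \<Longrightarrow> ip Y \<xi> \<eta> \<in> carrier A"
    and ip_add: "\<lbrakk>\<xi> \<in> carrier Y; \<eta> \<in> carrier Y; \<zeta> \<in> carrier Y\<rbrakk>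
      \<Longrightarrow> ip Y \<xi> (\<eta> \<oplus>\<^bsub>Y\<^esub> \<zeta>) = ip Y \<xi> \<eta> \<oplus>\<^bsub>A\<^esub> ip Y \<xi> \<zeta>"
    and ip_smult: "\<lbrakk>\<xi> \<in> carrier Y; \<eta> \<in> carrier Y\<rbrakk>
      \<Longrightarrow> ip Y \<xi> (c \<odot>\<^bsub>Y\<^esub> \<eta>) = c \<odot>\<^bsub>A\<^esub> ip Y \<xi> \<eta>"
    and ip_ract: "\<lbrakk>\<xi> \<in> carrier Y; \<eta> \<in> carrier Y; a \<in> carrier A\<rbrakk>
      \<Longrightarrow> ip Y \<xi> (ract Y \<eta> a) = ip Y \<xi> \<eta> \<otimes>\<^bsub>A\<^esub> a"
    and ip_star: "\<lbrakk>\<xi> \<in> carrier Y; \<eta> \<in> carrier Y\<rbrakk> \<Longrightarrow> star A (ip Y \<xi> \<eta>) = ip Y \<eta> \<xi>"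
    and ip_positive: "\<xi> \<in> carrier Y \<Longrightarrow> positive_in A (ip Y \<xi> \<xi>)"
    and ip_definite: "\<lbrakk>\<xi> \<in> carrier Y; ip Y \<xi> \<xi> = \<zero>\<^bsub>A\<^esub>\<rbrakk> \<Longrightarrow> \<xi> = \<zero>\<^bsub>Y\<^esub>"
    and complete: "norm_complete Y (hnorm A Y)"

definition adjoint_map ::
  "('a, 'x, 'm) bimod_scheme \<Rightarrow> ('a, 'y, 'n) bimod_scheme \<Rightarrow> ('x \<Rightarrow> 'y) \<Rightarrow> 'y \<Rightarrow> 'x" where
  "adjoint_map X Y T = (\<lambda>\<eta>\<in>carrier Y.
     THE \<xi>. \<xi> \<in> carrier X \<and> (\<forall>\<zeta>\<in>carrier X. ip X \<zeta> \<xi> = ip Y (T \<zeta>) \<eta>))"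

(* Operators are extensional functions, so that equality of operators is equality on the carrier. *)
definition adjointables :: "('a, 'x, 'n) bimod_scheme \<Rightarrow> ('x \<Rightarrow> 'x) set" where
  "adjointables Y = {T \<in> carrier Y \<rightarrow>\<^sub>E carrier Y. \<exists>T'\<in>carrier Y \<rightarrow> carrier Y.
     \<forall>\<xi>\<in>carrier Y. \<forall>\<eta>\<in>carrier Y. ip Y (T \<xi>) \<eta> = ip Y \<xi> (T' \<eta>)}"

(* The C*-algebra L(Y), with the operator norm. *)
definition adj_alg :: "('a, 'm) star_alg_scheme \<Rightarrow> ('a, 'x, 'n) bimod_scheme \<Rightarrow> ('x \<Rightarrow> 'x) star_alg" where
  "adj_alg A Y =
     \<lparr>carrier = adjointables Y,
      mult = (\<lambda>S T. \<lambda>\<xi>\<in>carrier Y. S (T \<xi>)),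
      one = (\<lambda>\<xi>\<in>carrier Y. \<xi>),
      zero = (\<lambda>\<xi>\<in>carrier Y. \<zero>\<^bsub>Y\<^esub>),
      add = (\<lambda>S T. \<lambda>\<xi>\<in>carrier Y. S \<xi> \<oplus>\<^bsub>Y\<^esub> T \<xi>),
      smult = (\<lambda>c T. \<lambda>\<xi>\<in>carrier Y. c \<odot>\<^bsub>Y\<^esub> T \<xi>),
      star = adjoint_map Y Y,
      nrm = (\<lambda>T. SUP \<xi>\<in>{\<xi> \<in> carrier Y. hnorm A Y \<xi> \<le> 1}. hnorm A Y (T \<xi>))\<rparr>"

definition left_op :: "('a, 'x, 'n) bimod_scheme \<Rightarrow> 'a \<Rightarrow> 'x \<Rightarrow> 'x" where
  "left_op Y a = (\<lambda>\<xi>\<in>carrier Y. lact Y a \<xi>)"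

definition hilbert_bimodule :: "('a, 'm) star_alg_scheme \<Rightarrow> ('a, 'x, 'n) bimod_scheme \<Rightarrow> bool" where
  "hilbert_bimodule A Y \<longleftrightarrow> right_hilbert_module A Y \<and> star_hom A (adj_alg A Y) (left_op Y)"

definition rank_one :: "('a, 'x, 'n) bimod_scheme \<Rightarrow> 'x \<Rightarrow> 'x \<Rightarrow> 'x \<Rightarrow> 'x" where
  "rank_one Y \<xi> \<eta> = (\<lambda>\<zeta>\<in>carrier Y. ract Y \<xi> (ip Y \<eta> \<zeta>))"

definition compacts :: "('a, 'm) star_alg_scheme \<Rightarrow> ('a, 'x, 'n) bimod_scheme \<Rightarrow> ('x \<Rightarrow> 'x) set" where
  "compacts A Y = closed_span (adj_alg A Y) {rank_one Y \<xi> \<eta> | \<xi> \<eta>. \<xi> \<in> carrier Y \<and> \<eta> \<in> carrier Y}"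

definition compact_alg ::
  "('a, 'm) star_alg_scheme \<Rightarrow> ('a, 'x, 'n) bimod_scheme \<Rightarrow> ('x \<Rightarrow> 'x) star_alg" where
  "compact_alg A Y = (adj_alg A Y)\<lparr>carrier := compacts A Y\<rparr>"

(* A as a bimodule over itself. *)
definition self_bimod :: "('a, 'm) star_alg_scheme \<Rightarrow> ('a, 'a) bimod" where
  "self_bimod A =
     \<lparr>carrier = carrier A, mult = mult A, one = one A, zero = zero A, add = add A, smult = smult A,
      ract = mult A, lact = mult A, ip = (\<lambda>a b. star A a \<otimes>\<^bsub>A\<^esub> b)\<rparr>"

definition bimod_iso ::
  "('a, 'm) star_alg_scheme \<Rightarrow> ('a, 'x, 'n) bimod_scheme \<Rightarrow> ('a, 'y, 'k) bimod_scheme \<Rightarrow> ('x \<Rightarrow> 'y) \<Rightarrow> bool" where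
  "bimod_iso A X Y F \<longleftrightarrow> linear_map X Y F \<and> bij_betw F (carrier X) (carrier Y)
     \<and> (\<forall>\<xi>\<in>carrier X. \<forall>a\<in>carrier A. F (ract X \<xi> a) = ract Y (F \<xi>) a)
     \<and> (\<forall>a\<in>carrier A. \<forall>\<xi>\<in>carrier X. F (lact X a \<xi>) = lact Y a (F \<xi>))
     \<and> (\<forall>\<xi>\<in>carrier X. \<forall>\<eta>\<in>carrier X. ip Y (F \<xi>) (F \<eta>) = ip X \<xi> \<eta>)"


section \<open>The balanced tensor product\<close>

text \<open>
  A list \<open>[(\<xi>\<^sub>1,\<eta>\<^sub>1),\<dots>,(\<xi>\<^sub>n,\<eta>\<^sub>n)]\<close> stands for the formal sum of the elementary tensors
  \<open>\<xi>\<^sub>j \<otimes> \<eta>\<^sub>j\<close>; scalars are absorbed into the first factor. The balanced tensor product is the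
  Hausdorff completion of the formal sums in the seminorm of the semi-inner product
  \<open>\<langle>\<xi>\<^sub>1 \<otimes> \<eta>\<^sub>1, \<xi>\<^sub>2 \<otimes> \<eta>\<^sub>2\<rangle> = \<langle>\<langle>\<xi>\<^sub>2,\<xi>\<^sub>1\<rangle>\<cdot>\<eta>\<^sub>1, \<eta>\<^sub>2\<rangle>\<close>: Cauchy sequences of formal sums modulo null sequences.
  Bilinearity and the balancing relation \<open>\<xi>\<cdot>a \<otimes> \<eta> = \<xi> \<otimes> a\<cdot>\<eta>\<close> need not be imposed separately, since
  the corresponding differences of formal sums have seminorm zero.
\<close>

definition fsums :: "('a, 'x, 'm) bimod_scheme \<Rightarrow> ('a, 'y, 'n) bimod_scheme \<Rightarrow> ('x \<times> 'y) list set" where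
  "fsums X Y = lists (carrier X \<times> carrier Y)"

definition fs_ip ::
  "('a, 'k) star_alg_scheme \<Rightarrow> ('a, 'x, 'm) bimod_scheme \<Rightarrow> ('a, 'y, 'n) bimod_scheme
     \<Rightarrow> ('x \<times> 'y) list \<Rightarrow> ('x \<times> 'y) list \<Rightarrow> 'a" where
  "fs_ip A X Y u v =
     (\<Oplus>\<^bsub>A\<^esub>p\<in>{..<length u} \<times> {..<length v}.
        ip Y (lact Y (ip X (fst (v ! snd p)) (fst (u ! fst p))) (snd (u ! fst p))) (snd (v ! snd p)))"

definition fs_norm ::
  "('a, 'k) star_alg_scheme \<Rightarrow> ('a, 'x, 'm) bimod_scheme \<Rightarrow> ('a, 'y, 'n) bimod_scheme
     \<Rightarrow> ('x \<times> 'y) list \<Rightarrow> real" where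
  "fs_norm A X Y u = sqrt (nrm A (fs_ip A X Y u u))"

definition fs_map1 :: "('x \<Rightarrow> 'x) \<Rightarrow> ('x \<times> 'y) list \<Rightarrow> ('x \<times> 'y) list" where
  "fs_map1 S = map (\<lambda>(\<xi>, \<eta>). (S \<xi>, \<eta>))"

definition fs_map2 :: "('y \<Rightarrow> 'y) \<Rightarrow> ('x \<times> 'y) list \<Rightarrow> ('x \<times> 'y) list" where
  "fs_map2 T = map (\<lambda>(\<xi>, \<eta>). (\<xi>, T \<eta>))"

definition fs_diff ::
  "('a, 'x, 'm) bimod_scheme \<Rightarrow> ('x \<times> 'y) list \<Rightarrow> ('x \<times> 'y) list \<Rightarrow> ('x \<times> 'y) list" where
  "fs_diff X u v = u @ fs_map1 (\<lambda>\<xi>. \<ominus>\<^bsub>X\<^esub> \<xi>) v"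

definition fs_cauchy ::
  "('a, 'k) star_alg_scheme \<Rightarrow> ('a, 'x, 'm) bimod_scheme \<Rightarrow> ('a, 'y, 'n) bimod_scheme
     \<Rightarrow> (nat \<Rightarrow> ('x \<times> 'y) list) set" where
  "fs_cauchy A X Y = {U. (\<forall>n. U n \<in> fsums X Y)
     \<and> (\<forall>e>0. \<exists>N. \<forall>m\<ge>N. \<forall>n\<ge>N. fs_norm A X Y (fs_diff X (U m) (U n)) < e)}"

definition fs_rel ::
  "('a, 'k) star_alg_scheme \<Rightarrow> ('a, 'x, 'm) bimod_scheme \<Rightarrow> ('a, 'y, 'n) bimod_scheme
     \<Rightarrow> (nat \<Rightarrow> ('x \<times> 'y) list) rel" where
  "fs_rel A X Y = {(U, V). U \<in> fs_cauchy A X Y \<and> V \<in> fs_cauchy A X Y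
     \<and> (\<lambda>n. fs_norm A X Y (fs_diff X (U n) (V n))) \<longlonglongrightarrow> 0}"

type_synonym ('x, 'y) tensor = "(nat \<Rightarrow> ('x \<times> 'y) list) set"

definition fs_class ::
  "('a, 'k) star_alg_scheme \<Rightarrow> ('a, 'x, 'm) bimod_scheme \<Rightarrow> ('a, 'y, 'n) bimod_scheme
     \<Rightarrow> (nat \<Rightarrow> ('x \<times> 'y) list) \<Rightarrow> ('x, 'y) tensor" where
  "fs_class A X Y U = fs_rel A X Y `` {U}"

definition fs_rep :: "('x, 'y) tensor \<Rightarrow> nat \<Rightarrow> ('x \<times> 'y) list" where
  "fs_rep p = (SOME U. U \<in> p)"

definition tensor_bimod ::
  "('a, 'k) star_alg_scheme \<Rightarrow> ('a, 'x, 'm) bimod_scheme \<Rightarrow> ('a, 'y, 'n) bimod_scheme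
     \<Rightarrow> ('a, ('x, 'y) tensor) bimod" where
  "tensor_bimod A X Y =
     \<lparr>carrier = fs_cauchy A X Y // fs_rel A X Y,
      mult = undefined, one = undefined,
      zero = fs_class A X Y (\<lambda>n. []),
      add = (\<lambda>p q. fs_class A X Y (\<lambda>n. fs_rep p n @ fs_rep q n)),
      smult = (\<lambda>c p. fs_class A X Y (\<lambda>n. fs_map1 (\<lambda>\<xi>. c \<odot>\<^bsub>X\<^esub> \<xi>) (fs_rep p n))),
      ract = (\<lambda>p a. fs_class A X Y (\<lambda>n. fs_map2 (\<lambda>\<eta>. ract Y \<eta> a) (fs_rep p n))),
      lact = (\<lambda>a p. fs_class A X Y (\<lambda>n. fs_map1 (left_op X a) (fs_rep p n))),
      ip = (\<lambda>p q. THE l. limitin (norm_topology A (nrm A))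
                   (\<lambda>n. fs_ip A X Y (fs_rep p n) (fs_rep q n)) l sequentially)\<rparr>"

definition elem_tensor ::
  "('a, 'k) star_alg_scheme \<Rightarrow> ('a, 'x, 'm) bimod_scheme \<Rightarrow> ('a, 'y, 'n) bimod_scheme
     \<Rightarrow> 'x \<Rightarrow> 'y \<Rightarrow> ('x, 'y) tensor" where
  "elem_tensor A X Y \<xi> \<eta> = fs_class A X Y (\<lambda>n. [(\<xi>, \<eta>)])"

(* S \<otimes> I on the balanced tensor product, for S in L(X). *)
definition op_tensor_id ::
  "('a, 'k) star_alg_scheme \<Rightarrow> ('a, 'x, 'm) bimod_scheme \<Rightarrow> ('a, 'y, 'n) bimod_scheme
     \<Rightarrow> ('x \<Rightarrow> 'x) \<Rightarrow> ('x, 'y) tensor \<Rightarrow> ('x, 'y) tensor" where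
  "op_tensor_id A X Y S = (\<lambda>p\<in>carrier (tensor_bimod A X Y).
     fs_class A X Y (\<lambda>n. fs_map1 S (fs_rep p n)))"


section \<open>Quasi-lattice ordered groups\<close>

definition qle :: "('g, 'm) monoid_scheme \<Rightarrow> 'g set \<Rightarrow> 'g \<Rightarrow> 'g \<Rightarrow> bool" where
  "qle G P s r \<longleftrightarrow> inv\<^bsub>G\<^esub> s \<otimes>\<^bsub>G\<^esub> r \<in> P"

definition joinable :: "('g, 'm) monoid_scheme \<Rightarrow> 'g set \<Rightarrow> 'g \<Rightarrow> 'g \<Rightarrow> bool" where
  "joinable G P s r \<longleftrightarrow> (\<exists>u\<in>P. qle G P s u \<and> qle G P r u)"

(* Least among the upper bounds lying in P. For s, r in P every upper bound lies in P; for general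
   s, r in G the least upper bound in all of G need not lie in P (take s = r = -1 in (Z, N)). *)
definition is_join :: "('g, 'm) monoid_scheme \<Rightarrow> 'g set \<Rightarrow> 'g \<Rightarrow> 'g \<Rightarrow> 'g \<Rightarrow> bool" where
  "is_join G P s r t \<longleftrightarrow> t \<in> P \<and> qle G P s t \<and> qle G P r t
     \<and> (\<forall>u\<in>P. qle G P s u \<and> qle G P r u \<longrightarrow> qle G P t u)"

definition join :: "('g, 'm) monoid_scheme \<Rightarrow> 'g set \<Rightarrow> 'g \<Rightarrow> 'g \<Rightarrow> 'g" where
  "join G P s r = (THE t. is_join G P s r t)"

definition quasi_lattice_ordered :: "('g, 'm) monoid_scheme \<Rightarrow> 'g set \<Rightarrow> bool" where
  "quasi_lattice_ordered G P \<longleftrightarrow> group G \<and> P \<subseteq> carrier G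
     \<and> (\<forall>s\<in>P. \<forall>r\<in>P. s \<otimes>\<^bsub>G\<^esub> r \<in> P)
     \<and> P \<inter> m_inv G ` P = {\<one>\<^bsub>G\<^esub>}
     \<and> (\<forall>s\<in>carrier G. \<forall>r\<in>carrier G. joinable G P s r \<longrightarrow> (\<exists>t. is_join G P s r t))"


section \<open>Product systems\<close>

text \<open>
  The product system is the disjoint union of the fibres, \<open>pmul X s r\<close> being the product on
  \<open>X\<^sub>s \<times> X\<^sub>r\<close>. All fibres live in one type, which is also the type of the coefficient algebra since
  \<open>X\<^sub>e = A\<close>; as carriers are arbitrary subsets, this is no restriction.
\<close>

record ('g, 'x) prod_sys =
  coeff :: "'x star_alg"
  fib :: "'g \<Rightarrow> ('x, 'x) bimod"
  pmul :: "'g \<Rightarrow> 'g \<Rightarrow> 'x \<Rightarrow> 'x \<Rightarrow> 'x"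

abbreviation fib_tensor :: "('g, 'x, 'm) prod_sys_scheme \<Rightarrow> 'g \<Rightarrow> 'g \<Rightarrow> ('x, ('x, 'x) tensor) bimod" where
  "fib_tensor X s r \<equiv> tensor_bimod (coeff X) (fib X s) (fib X r)"

definition is_prod_iso ::
  "('g, 'k) monoid_scheme \<Rightarrow> ('g, 'x, 'm) prod_sys_scheme \<Rightarrow> 'g \<Rightarrow> 'g \<Rightarrow> (('x, 'x) tensor \<Rightarrow> 'x) \<Rightarrow> bool" where
  "is_prod_iso G X s r F \<longleftrightarrow>
     F \<in> extensional (carrier (fib_tensor X s r))
     \<and> bimod_iso (coeff X) (fib_tensor X s r) (fib X (s \<otimes>\<^bsub>G\<^esub> r)) F
     \<and> (\<forall>\<xi>\<in>carrier (fib X s). \<forall>\<eta>\<in>carrier (fib X r).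
          F (elem_tensor (coeff X) (fib X s) (fib X r) \<xi> \<eta>) = pmul X s r \<xi> \<eta>)"

(* F^{s,r}; unique because elementary tensors span a dense subspace. *)
definition prod_iso ::
  "('g, 'k) monoid_scheme \<Rightarrow> ('g, 'x, 'm) prod_sys_scheme \<Rightarrow> 'g \<Rightarrow> 'g \<Rightarrow> ('x, 'x) tensor \<Rightarrow> 'x" where
  "prod_iso G X s r = (THE F. is_prod_iso G X s r F)"

definition product_system ::
  "('g, 'k) monoid_scheme \<Rightarrow> 'g set \<Rightarrow> ('g, 'x, 'm) prod_sys_scheme \<Rightarrow> bool" where
  "product_system G P X \<longleftrightarrow>
     cstar_algebra (coeff X) \<and> unital (coeff X)
     \<and> (\<forall>s\<in>P. hilbert_bimodule (coeff X) (fib X s))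
     \<and> fib X \<one>\<^bsub>G\<^esub> = self_bimod (coeff X)
     \<and> (\<forall>s\<in>P. \<forall>r\<in>P. \<forall>\<xi>\<in>carrier (fib X s). \<forall>\<eta>\<in>carrier (fib X r).
          pmul X s r \<xi> \<eta> \<in> carrier (fib X (s \<otimes>\<^bsub>G\<^esub> r)))
     \<and> (\<forall>s\<in>P. \<forall>r\<in>P. \<forall>t\<in>P.
          \<forall>\<xi>\<in>carrier (fib X s). \<forall>\<eta>\<in>carrier (fib X r). \<forall>\<zeta>\<in>carrier (fib X t).
            pmul X (s \<otimes>\<^bsub>G\<^esub> r) t (pmul X s r \<xi> \<eta>) \<zeta> = pmul X s (r \<otimes>\<^bsub>G\<^esub> t) \<xi> (pmul X r t \<eta> \<zeta>))
     \<and> (\<forall>s\<in>P - {\<one>\<^bsub>G\<^esub>}. \<forall>r\<in>P - {\<one>\<^bsub>G\<^esub>}. \<exists>F. is_prod_iso G X s r F)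
     \<and> (\<forall>s\<in>P. \<forall>a\<in>carrier (coeff X). \<forall>\<xi>\<in>carrier (fib X s).
          pmul X \<one>\<^bsub>G\<^esub> s a \<xi> = lact (fib X s) a \<xi> \<and> pmul X s \<one>\<^bsub>G\<^esub> \<xi> a = ract (fib X s) \<xi> a)"

(* The homomorphism i_s^t for t = sr. For s = e, the unital algebra A is identified with L(A_A),
   the operator S corresponding to the element S(1); so i_e^t(S) is \<phi>_t(S(1)). *)
definition fib_embed ::
  "('g, 'k) monoid_scheme \<Rightarrow> ('g, 'x, 'm) prod_sys_scheme \<Rightarrow> 'g \<Rightarrow> 'g \<Rightarrow> ('x \<Rightarrow> 'x) \<Rightarrow> 'x \<Rightarrow> 'x" where
  "fib_embed G X s t S =
     (if s = \<one>\<^bsub>G\<^esub> then left_op (fib X t) (S \<one>\<^bsub>coeff X\<^esub>)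
      else if t = s then S
      else let r = inv\<^bsub>G\<^esub> s \<otimes>\<^bsub>G\<^esub> t; F = prod_iso G X s r in
        (\<lambda>\<zeta>\<in>carrier (fib X t).
           F (op_tensor_id (coeff X) (fib X s) (fib X r) S
                (adjoint_map (fib_tensor X s r) (fib X t) F \<zeta>))))"

definition embed_mult ::
  "('g, 'k) monoid_scheme \<Rightarrow> ('g, 'x, 'm) prod_sys_scheme \<Rightarrow> 'g \<Rightarrow> 'g \<Rightarrow> 'g
     \<Rightarrow> ('x \<Rightarrow> 'x) \<Rightarrow> ('x \<Rightarrow> 'x) \<Rightarrow> 'x \<Rightarrow> 'x" where
  "embed_mult G X s r t S T =
     fib_embed G X s t S \<otimes>\<^bsub>adj_alg (coeff X) (fib X t)\<^esub> fib_embed G X r t T"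

definition compactly_aligned ::
  "('g, 'k) monoid_scheme \<Rightarrow> 'g set \<Rightarrow> ('g, 'x, 'm) prod_sys_scheme \<Rightarrow> bool" where
  "compactly_aligned G P X \<longleftrightarrow>
     (\<forall>s\<in>P. \<forall>r\<in>P. joinable G P s r \<longrightarrow>
       (\<forall>S\<in>compacts (coeff X) (fib X s). \<forall>T\<in>compacts (coeff X) (fib X r).
          embed_mult G X s r (join G P s r) S T \<in> compacts (coeff X) (fib X (join G P s r))))"


section \<open>Nica covariant Toeplitz representations\<close>

definition toeplitz_rep ::
  "('g, 'k) monoid_scheme \<Rightarrow> 'g set \<Rightarrow> ('g, 'x, 'm) prod_sys_scheme
     \<Rightarrow> ('c, 'n) star_alg_scheme \<Rightarrow> ('g \<Rightarrow> 'x \<Rightarrow> 'c) \<Rightarrow> bool" where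
  "toeplitz_rep G P X C \<psi> \<longleftrightarrow>
     (\<forall>s\<in>P. linear_map (fib X s) C (\<psi> s))
     \<and> star_hom (coeff X) C (\<psi> \<one>\<^bsub>G\<^esub>)
     \<and> (\<forall>s\<in>P. \<forall>r\<in>P. \<forall>\<xi>\<in>carrier (fib X s). \<forall>\<eta>\<in>carrier (fib X r).
          \<psi> s \<xi> \<otimes>\<^bsub>C\<^esub> \<psi> r \<eta> = \<psi> (s \<otimes>\<^bsub>G\<^esub> r) (pmul X s r \<xi> \<eta>))
     \<and> (\<forall>s\<in>P. \<forall>\<xi>\<in>carrier (fib X s). \<forall>\<eta>\<in>carrier (fib X s).
          star C (\<psi> s \<xi>) \<otimes>\<^bsub>C\<^esub> \<psi> s \<eta> = \<psi> \<one>\<^bsub>G\<^esub> (ip (fib X s) \<xi> \<eta>))"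

(* The induced homomorphism \<psi>^{(s)} on K(X_s). *)
definition compact_rep ::
  "('g, 'x, 'm) prod_sys_scheme \<Rightarrow> ('c, 'n) star_alg_scheme \<Rightarrow> ('g \<Rightarrow> 'x \<Rightarrow> 'c)
     \<Rightarrow> 'g \<Rightarrow> ('x \<Rightarrow> 'x) \<Rightarrow> 'c" where
  "compact_rep X C \<psi> s =
     (THE h. h \<in> extensional (compacts (coeff X) (fib X s))
        \<and> star_hom (compact_alg (coeff X) (fib X s)) C h
        \<and> (\<forall>\<xi>\<in>carrier (fib X s). \<forall>\<eta>\<in>carrier (fib X s).
             h (rank_one (fib X s) \<xi> \<eta>) = \<psi> s \<xi> \<otimes>\<^bsub>C\<^esub> star C (\<psi> s \<eta>)))"

definition nica_covariant ::
  "('g, 'k) monoid_scheme \<Rightarrow> 'g set \<Rightarrow> ('g, 'x, 'm) prod_sys_scheme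
     \<Rightarrow> ('c, 'n) star_alg_scheme \<Rightarrow> ('g \<Rightarrow> 'x \<Rightarrow> 'c) \<Rightarrow> bool" where
  "nica_covariant G P X C \<psi> \<longleftrightarrow> toeplitz_rep G P X C \<psi>
     \<and> (\<forall>s\<in>P. \<forall>r\<in>P.
          \<forall>S\<in>compacts (coeff X) (fib X s). \<forall>T\<in>compacts (coeff X) (fib X r).
            compact_rep X C \<psi> s S \<otimes>\<^bsub>C\<^esub> compact_rep X C \<psi> r T =
              (if joinable G P s r
               then compact_rep X C \<psi> (join G P s r) (embed_mult G X s r (join G P s r) S T)
               else \<zero>\<^bsub>C\<^esub>))"

text \<open>
  HOL cannot quantify over all types inside a formula, but universality only has to be tested on
  the C*-algebras generated by a representation of \<open>X\<close>. Every element of such an algebra is the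
  limit of a sequence of finite sums of words in the \<open>\<psi>\<^sub>s(\<xi>)\<close> and \<open>\<psi>\<^sub>s(\<xi>)*\<close> (scalars can be absorbed
  into \<open>\<xi>\<close>). A word is a list over \<open>bool \<times> 'g \<times> 'x\<close>, the flag marking adjoints, so all of these
  algebras have isomorphic copies carried by subsets of the following type.
\<close>

type_synonym ('g, 'x) word_seq = "nat \<Rightarrow> (bool \<times> 'g \<times> 'x) list list"

(* (B, i) is NT(X) with its universal representation. The last clause is generation by i: the
   C*-algebra generated by a Nica covariant representation is the closed span of these monomials. *)
definition nica_toeplitz_algebra ::
  "('g, 'k) monoid_scheme \<Rightarrow> 'g set \<Rightarrow> ('g, 'x, 'm) prod_sys_scheme
     \<Rightarrow> ('b, 'n) star_alg_scheme \<Rightarrow> ('g \<Rightarrow> 'x \<Rightarrow> 'b) \<Rightarrow> bool" where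
  "nica_toeplitz_algebra G P X B i \<longleftrightarrow>
     cstar_algebra B \<and> nica_covariant G P X B i
     \<and> (\<forall>(C :: ('g, 'x) word_seq star_alg) \<psi>.
          cstar_algebra C \<and> nica_covariant G P X C \<psi> \<longrightarrow>
            (\<exists>h. star_hom B C h \<and> (\<forall>s\<in>P. \<forall>\<xi>\<in>carrier (fib X s). h (i s \<xi>) = \<psi> s \<xi>)))
     \<and> carrier B = closed_span B
          {i s \<xi> \<otimes>\<^bsub>B\<^esub> star B (i r \<eta>) | s r \<xi> \<eta>.
             s \<in> P \<and> r \<in> P \<and> \<xi> \<in> carrier (fib X s) \<and> \<eta> \<in> carrier (fib X r)}"

definition core ::
  "'g set \<Rightarrow> ('g, 'x, 'm) prod_sys_scheme \<Rightarrow> ('b, 'n) star_alg_scheme \<Rightarrow> ('g \<Rightarrow> 'x \<Rightarrow> 'b) \<Rightarrow> 'b set" where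
  "core P X B i = closed_span B
     {i s \<xi> \<otimes>\<^bsub>B\<^esub> star B (i s \<eta>) | s \<xi> \<eta>. s \<in> P \<and> \<xi> \<in> carrier (fib X s) \<and> \<eta> \<in> carrier (fib X s)}"

definition core_expectation ::
  "'g set \<Rightarrow> ('g, 'x, 'm) prod_sys_scheme \<Rightarrow> ('b, 'n) star_alg_scheme \<Rightarrow> ('g \<Rightarrow> 'x \<Rightarrow> 'b)
     \<Rightarrow> ('b \<Rightarrow> 'b) \<Rightarrow> bool" where
  "core_expectation P X B i \<Phi> \<longleftrightarrow> conditional_expectation B (core P X B i) \<Phi>
     \<and> (\<forall>s\<in>P. \<forall>r\<in>P. \<forall>\<xi>\<in>carrier (fib X s). \<forall>\<eta>\<in>carrier (fib X r).
          \<Phi> (i s \<xi> \<otimes>\<^bsub>B\<^esub> star B (i r \<eta>)) =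
            (if s = r then i s \<xi> \<otimes>\<^bsub>B\<^esub> star B (i s \<eta>) else \<zero>\<^bsub>B\<^esub>))"

definition positive_reals :: "real monoid" where
  "positive_reals = \<lparr>carrier = {0<..}, mult = (*), one = 1\<rparr>"

definition dynamics_from ::
  "('g, 'k) monoid_scheme \<Rightarrow> 'g set \<Rightarrow> ('g, 'x, 'm) prod_sys_scheme \<Rightarrow> ('b, 'n) star_alg_scheme
     \<Rightarrow> ('g \<Rightarrow> 'x \<Rightarrow> 'b) \<Rightarrow> ('g \<Rightarrow> real) \<Rightarrow> (real \<Rightarrow> 'b \<Rightarrow> 'b) \<Rightarrow> bool" where
  "dynamics_from G P X B i N \<sigma> \<longleftrightarrow> dynamics B \<sigma>
     \<and> (\<forall>t. \<forall>a\<in>carrier (coeff X). \<sigma> t (i \<one>\<^bsub>G\<^esub> a) = i \<one>\<^bsub>G\<^esub> a)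
     \<and> (\<forall>t. \<forall>s\<in>P. \<forall>\<xi>\<in>carrier (fib X s).
          \<sigma> t (i s \<xi>) = (complex_of_real (N s) powr (\<i> * complex_of_real t)) \<odot>\<^bsub>B\<^esub> i s \<xi>)"

end

theory Submission
  imports Defs
begin

text \<open>
  The elements \<open>i\<^sub>s(\<xi>)\<close> and \<open>i\<^sub>s(\<xi>)*\<close> are eigenvectors of the dynamics with eigenvalues \<open>N(s)\<^bsup>it\<^esup>\<close> and
  \<open>N(s)\<^bsup>-it\<^esup>\<close>, and the core is fixed pointwise. Hence \<open>\<omega>(cd) = \<lambda>\<^bsup>-\<beta>\<^esup> \<omega>(dc)\<close> whenever \<open>c\<close> has eigenvalue
  \<open>\<lambda>\<^bsup>it\<^esup>\<close> and \<open>d\<close> is an eigenvector. This gives the trace property on the core and the scaling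
  identity; applied twice, it shows that \<open>\<omega>\<close> vanishes on \<open>i\<^sub>s(\<xi>) y i\<^sub>r(\<eta>)*\<close> when \<open>N(s) \<noteq> N(r)\<close>, so
  that \<open>\<omega>\<close> and \<open>\<omega> \<circ> \<Phi>\<close> agree on a spanning set. The algebra need not be unital,
  because left actions may be degenerate; so the vanishing is proved by moving
  \<open>i\<^sub>s(\<xi>) y\<close> around \<open>i\<^sub>r(\<eta>)*\<close> and back rather than by pairing with a unit.
\<close>

section \<open>Scalar arithmetic and linear maps in a C*-algebra\<close>

lemma complex_field_simps [simp]:
  "carrier complex_field = UNIV" "mult complex_field = (*)" "one complex_field = 1"
  "zero complex_field = 0" "add complex_field = (+)"
  by (simp_all add: complex_field_def)

context cstar_algebra
begin

sublocale V: Module.module complex_field C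
  by (rule vector_space)

lemma smult_in_carrier [simp]: "x \<in> carrier C \<Longrightarrow> c \<odot> x \<in> carrier C"
  by (rule V.smult_closed) simp_all

lemma add_smult: "x \<in> carrier C \<Longrightarrow> (a + b) \<odot> x = a \<odot> x \<oplus> b \<odot> x"
  using V.smult_l_distr[of a b x] by simp

lemma smult_smult: "x \<in> carrier C \<Longrightarrow> a \<odot> (b \<odot> x) = (a * b) \<odot> x"
  using V.smult_assoc1[of a b x] by simp

lemma smult_0 [simp]: "x \<in> carrier C \<Longrightarrow> 0 \<odot> x = \<zero>"
  using V.smult_l_null[of x] by simp

lemma smult_1 [simp]: "x \<in> carrier C \<Longrightarrow> 1 \<odot> x = x"
  using V.smult_one[of x] by simp

lemma minus_smult: "x \<in> carrier C \<Longrightarrow> \<ominus> (c \<odot> x) = (- c) \<odot> x"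
  by (rule V.M.minus_equality) (simp_all flip: add_smult)

lemma uminus_eq_smult: "x \<in> carrier C \<Longrightarrow> \<ominus> x = (- 1) \<odot> x"
  using minus_smult[of x 1] by simp

lemma diff_smult: "x \<in> carrier C \<Longrightarrow> (a - b) \<odot> x = a \<odot> x \<ominus> b \<odot> x"
  using add_smult[of x a "- b"] by (simp add: a_minus_def minus_smult)

lemma linear_mapD:
  assumes "linear_map C D h" "x \<in> carrier C"
  shows "h x \<in> carrier D"
    and "y \<in> carrier C \<Longrightarrow> h (x \<oplus> y) = h x \<oplus>\<^bsub>D\<^esub> h y"
    and "h (c \<odot> x) = c \<odot>\<^bsub>D\<^esub> h x"
  using assms by (auto simp: linear_map_def)

lemma linear_map_diff:
  assumes "linear_map C C h" "x \<in> carrier C" "y \<in> carrier C"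
  shows "h (x \<ominus> y) = h x \<ominus> h y"
  using assms by (simp add: a_minus_def uminus_eq_smult linear_mapD)

lemma linear_map_zero:
  assumes "linear_map C C h"
  shows "h \<zero> = \<zero>"
  using linear_mapD(1,3)[OF assms, of "\<zero>"] V.smult_r_null[of 0] smult_0 V.M.zero_closed
  by metis

lemma nrm_uminus: "x \<in> carrier C \<Longrightarrow> nrm C (\<ominus> x) = nrm C x"
  by (simp add: uminus_eq_smult nrm_smult)

section \<open>Norm topology, bounded linear maps and closed spans\<close>

sublocale M: Metric_space "carrier C" "norm_dist C (nrm C)"
proof
  fix x y
  show "0 \<le> norm_dist C (nrm C) x y"
    by (simp add: norm_dist_def nrm_nonneg)
  show "norm_dist C (nrm C) x y = norm_dist C (nrm C) y x"
    using nrm_uminus[of "x \<ominus> y"]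
    by (auto simp: norm_dist_def a_minus_def V.M.minus_add V.M.a_comm)
next
  fix x y assume "x \<in> carrier C" "y \<in> carrier C"
  moreover have "x = y" if "x \<ominus> y = \<zero>"
    using V.M.minus_equality[of x "\<ominus> y"] that calculation by (simp add: a_minus_def)
  ultimately show "norm_dist C (nrm C) x y = 0 \<longleftrightarrow> x = y"
    by (auto simp: norm_dist_def nrm_eq_0 a_minus_def V.M.r_neg)
next
  fix x y z assume xyz: "x \<in> carrier C" "y \<in> carrier C" "z \<in> carrier C"
  then have "x \<ominus> z = (x \<ominus> y) \<oplus> (y \<ominus> z)"
    by (simp add: a_minus_def V.M.a_assoc V.M.r_neg1)
  then show "norm_dist C (nrm C) x z \<le> norm_dist C (nrm C) x y + norm_dist C (nrm C) y z"
    using xyz by (simp add: norm_dist_def nrm_triangle)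
qed

abbreviation ntop :: "'a topology" where
  "ntop \<equiv> norm_topology C (nrm C)"

lemma topspace_ntop [simp]: "topspace ntop = carrier C"
  by (simp add: norm_topology_def)

lemma Hausdorff_ntop: "Hausdorff_space ntop"
  by (simp add: norm_topology_def M.Hausdorff_space_mtopology)

text \<open>The target metric is arbitrary so that one Lipschitz estimate serves both maps of the
  algebra into itself and functionals into the complex plane.\<close>

lemma continuous_map_ntop:
  assumes "Metric_space M' d'" "f \<in> carrier C \<rightarrow> M'"
    and lip: "\<And>x y. x \<in> carrier C \<Longrightarrow> y \<in> carrier C \<Longrightarrow> d' (f x) (f y) \<le> K * nrm C (x \<ominus> y)"
  shows "continuous_map ntop (Metric_space.mtopology M' d') f"
  unfolding norm_topology_def M.metric_continuous_map[OF assms(1)]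
proof (intro conjI ballI allI impI)
  show "f ` carrier C \<subseteq> M'" using assms(2) by auto
next
  fix a and e :: real assume a: "a \<in> carrier C" and "0 < e"
  show "\<exists>d>0. \<forall>x. x \<in> carrier C \<and> norm_dist C (nrm C) a x < d \<longrightarrow> d' (f a) (f x) < e"
  proof (intro exI conjI allI impI)
    \<comment> \<open>\<open>K\<close> may be zero or negative; the summand 1 keeps the divisor
      positive.\<close>
    show "0 < e / (\<bar>K\<bar> + 1)" using \<open>0 < e\<close> by simp
    fix x assume *: "x \<in> carrier C \<and> norm_dist C (nrm C) a x < e / (\<bar>K\<bar> + 1)"
    then have x: "x \<in> carrier C" by simp
    then have "nrm C (a \<ominus> x) * (\<bar>K\<bar> + 1) < e"
      using conjunct2[OF *] a by (simp add: norm_dist_def pos_less_divide_eq)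
    moreover have "K * nrm C (a \<ominus> x) \<le> (\<bar>K\<bar> + 1) * nrm C (a \<ominus> x)"
      using a x by (intro mult_right_mono nrm_nonneg) auto
    ultimately show "d' (f a) (f x) < e"
      using lip[of a x] a x by (simp add: mult.commute)
  qed
qed

lemma continuous_map_bounded_linear:
  assumes h: "linear_map C C h" and K: "\<And>x. x \<in> carrier C \<Longrightarrow> nrm C (h x) \<le> K * nrm C x"
  shows "continuous_map ntop ntop h"
proof -
  have "norm_dist C (nrm C) (h x) (h y) \<le> K * nrm C (x \<ominus> y)" if "x \<in> carrier C" "y \<in> carrier C" for x y
    using K[of "x \<ominus> y"] that linear_mapD(1)[OF h] by (simp add: norm_dist_def linear_map_diff[OF h])
  moreover have "h \<in> carrier C \<rightarrow> carrier C"
    using linear_mapD(1)[OF h] by auto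
  ultimately show ?thesis
    using continuous_map_ntop[OF M.Metric_space_axioms] norm_topology_def by metis
qed

lemma closed_span_superset:
  assumes "S \<subseteq> carrier C"
  shows "S \<subseteq> closed_span C S"
proof -
  have "S \<subseteq> lin_span C S" by (auto simp: lin_span_def)
  moreover have "lin_span C S \<subseteq> carrier C"
    using assms V.carrier_is_submodule by (auto simp: lin_span_def)
  ultimately show ?thesis
    using closure_of_subset[of "lin_span C S" ntop] by (auto simp: closed_span_def)
qed

text \<open>The elements satisfying \<open>Q\<close> form a closed subspace, which contains the
  closed span as soon as it contains \<open>S\<close>. Identities between continuous linear maps are
  thereby reduced to generators.\<close>

lemma closed_span_induct [consumes 1, case_names closed zero add smult base]:
  assumes x: "x \<in> closed_span C S" 
    and closed: "closedin ntop {x \<in> carrier C. Q x}"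
    and zero: "Q \<zero>"
    and add: "\<And>x y. x \<in> carrier C \<Longrightarrow> y \<in> carrier C \<Longrightarrow> Q x \<Longrightarrow> Q y \<Longrightarrow> Q (x \<oplus> y)"
    and smult: "\<And>c x. x \<in> carrier C \<Longrightarrow> Q x \<Longrightarrow> Q (c \<odot> x)"
    and base: "\<And>x. x \<in> S \<Longrightarrow> x \<in> carrier C \<and> Q x"
  shows "Q x"
proof -
  have "submodule {x \<in> carrier C. Q x} complex_field C"
    by (rule V.submoduleI) (auto simp: zero add smult uminus_eq_smult)
  then have "lin_span C S \<subseteq> {x \<in> carrier C. Q x}"
    using base by (auto simp: lin_span_def)
  then have "closed_span C S \<subseteq> {x \<in> carrier C. Q x}"
    unfolding closed_span_def using closed by (rule closure_of_minimal)
  with x show ?thesis by auto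
qed

section \<open>Entire orbits, states and the KMS condition\<close>

lemma entire_smult:
  assumes "\<And>z. (g has_field_derivative g' z) (at z)" and c: "c \<in> carrier C"
  shows "entire C (\<lambda>z. g z \<odot> c)"
  unfolding entire_def
proof (intro conjI allI)
  show "g z \<odot> c \<in> carrier C" for z using c by simp
  show "\<exists>D\<in>carrier C. ((\<lambda>w. nrm C ((1 / (w - z)) \<odot> (g w \<odot> c \<ominus> g z \<odot> c) \<ominus> D)) \<longlongrightarrow> 0) (at z)" for z
  proof
    show "g' z \<odot> c \<in> carrier C" using c by simp
    have "((\<lambda>w. (g w - g z) / (w - z)) \<longlongrightarrow> g' z) (at z)"
      using assms(1)[of z] by (simp add: has_field_derivative_iff)
    then have "((\<lambda>w. cmod ((g w - g z) / (w - z) - g' z) * nrm C c) \<longlongrightarrow> 0) (at z)"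
      by (intro tendsto_mult_left_zero tendsto_norm_zero) (simp add: LIM_zero)
    \<comment> \<open>The error of the difference quotient is a scalar multiple of the fixed vector
      \<open>c\<close>, so the vector limit reduces to the scalar one.\<close>
    moreover have "(1 / (w - z)) \<odot> (g w \<odot> c \<ominus> g z \<odot> c) \<ominus> g' z \<odot> c
        = ((g w - g z) / (w - z) - g' z) \<odot> c" for w
      using c by (simp add: smult_smult flip: diff_smult)
    ultimately show "((\<lambda>w. nrm C ((1 / (w - z)) \<odot> (g w \<odot> c \<ominus> g z \<odot> c) \<ominus> g' z \<odot> c)) \<longlongrightarrow> 0) (at z)"
      using c by (simp add: nrm_smult)
  qed
qed

text \<open>The supremum over the unit ball is 1, so rescaling to norm one gives the bound; norm
  zero is separated because the rescaling divides by the norm.\<close>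

lemma state_bound:
  assumes "state C \<omega>" and x: "x \<in> carrier C"
  shows "cmod (\<omega> x) \<le> nrm C x"
proof (cases "nrm C x = 0")
  case True
  then have "x = \<zero>" using x nrm_eq_0 by blast
  moreover have "\<omega> (0 \<odot> x) = 0 * \<omega> x"
    using assms unfolding state_def by blast
  ultimately show ?thesis using x nrm_nonneg[OF x] by simp
next
  case False
  define r where "r = nrm C x"
  have r: "r > 0" using False nrm_nonneg[OF x] by (simp add: r_def)
  let ?y = "complex_of_real (inverse r) \<odot> x"
  have "nrm C ?y = 1" using x r by (simp add: nrm_smult r_def norm_inverse)
  then have "cmod (\<omega> ?y) \<le> (SUP x\<in>{x \<in> carrier C. nrm C x \<le> 1}. cmod (\<omega> x))"
    using assms by (intro cSUP_upper) (auto simp: state_def)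
  also have "\<dots> = 1" using assms by (simp add: state_def)
  finally have "cmod (\<omega> ?y) \<le> 1" .
  moreover have "\<omega> ?y = complex_of_real (inverse r) * \<omega> x"
    using assms unfolding state_def by blast
  ultimately have "inverse r * cmod (\<omega> x) \<le> 1" using r by (simp add: norm_mult norm_inverse)
  then show ?thesis using r by (simp add: field_simps r_def)
qed

lemma continuous_map_state:
  assumes s: "state C \<omega>"
  shows "continuous_map ntop euclidean \<omega>"
proof -
  have "dist (\<omega> x) (\<omega> y) \<le> 1 * nrm C (x \<ominus> y)" if "x \<in> carrier C" "y \<in> carrier C" for x y
  proof -
    have "\<omega> (x \<ominus> y) = \<omega> x - \<omega> y"
      using s that by (simp add: state_def a_minus_def uminus_eq_smult)
    then show ?thesis
      using state_bound[OF s, of "x \<ominus> y"] that by (simp add: dist_norm)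
  qed
  then show ?thesis
    using continuous_map_ntop[OF Met_TC.Metric_space_axioms, of \<omega> 1] by simp
qed

text \<open>Eigenvectors of the dynamics are analytic, and on them the KMS condition becomes a
  commutation relation that does not mention analytic continuation.\<close>

lemma eigenvector_entire_extension:
  assumes "c \<in> carrier C" and "\<And>t. \<sigma> t c = exp (\<i> * complex_of_real (a * t)) \<odot> c"
  shows "entire_extension C \<sigma> c (\<lambda>z. exp (\<i> * complex_of_real a * z) \<odot> c)"
  unfolding entire_extension_def
proof
  show "entire C (\<lambda>z. exp (\<i> * complex_of_real a * z) \<odot> c)"
    by (rule entire_smult) (auto intro!: derivative_eq_intros assms(1))
qed (simp add: assms(2) mult.assoc)

lemma KMS_eigenvector:
  assumes KMS: "KMS_state C \<sigma> \<beta> \<omega>"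
    and c: "c \<in> carrier C" "\<And>t. \<sigma> t c = exp (\<i> * complex_of_real (a * t)) \<odot> c"
    and d: "d \<in> carrier C" "\<And>t. \<sigma> t d = exp (\<i> * complex_of_real (b * t)) \<odot> d"
  shows "\<omega> (c \<otimes> d) = exp (- (a * \<beta>)) * \<omega> (d \<otimes> c)"
proof -
  note ext = eigenvector_entire_extension[of c \<sigma> a, OF c] eigenvector_entire_extension[of d \<sigma> b, OF d]
  then have "c \<in> analytic_elements C \<sigma>" "d \<in> analytic_elements C \<sigma>"
    using c d by (auto simp: analytic_elements_def)
  with KMS ext(1) have "\<omega> (c \<otimes> d)
      = \<omega> (d \<otimes> (exp (\<i> * complex_of_real a * (\<i> * complex_of_real \<beta>)) \<odot> c))"
    unfolding KMS_state_def by blast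
  \<comment> \<open>At z = i\<beta> the phase exp(iaz) becomes the real factor
    exp(-a\<beta>).\<close>
  also have "\<i> * complex_of_real a * (\<i> * complex_of_real \<beta>) = complex_of_real (- (a * \<beta>))"
    by (simp add: algebra_simps)
  also have "\<omega> (d \<otimes> (exp (complex_of_real (- (a * \<beta>))) \<odot> c)) = exp (- (a * \<beta>)) * \<omega> (d \<otimes> c)"
    using KMS c d unfolding KMS_state_def state_def
    by (simp add: smult_mult_r mult_closed flip: exp_of_real)
  finally show ?thesis .
qed

text \<open>Moving \<open>c\<close> past \<open>d\<close> and then \<open>d\<close> past
  \<open>c\<close> reproduces \<open>\<omega> (c \<otimes> d)\<close> with the factor
  exp(-(a+b)\<beta>), which differs from 1.\<close>

lemma KMS_eigenvector_mult_eq_0: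
  assumes KMS: "KMS_state C \<sigma> \<beta> \<omega>" and "\<beta> \<noteq> 0"
    and c: "c \<in> carrier C" "\<And>t. \<sigma> t c = exp (\<i> * complex_of_real (a * t)) \<odot> c"
    and d: "d \<in> carrier C" "\<And>t. \<sigma> t d = exp (\<i> * complex_of_real (b * t)) \<odot> d"
    and "a + b \<noteq> 0"
  shows "\<omega> (c \<otimes> d) = 0"
proof -
  have "\<omega> (c \<otimes> d) = exp (- (a * \<beta>)) * (exp (- (b * \<beta>)) * \<omega> (c \<otimes> d))"
    using KMS_eigenvector[OF KMS c d] KMS_eigenvector[OF KMS d c] by simp
  also have "\<dots> = exp (- ((a + b) * \<beta>)) * \<omega> (c \<otimes> d)"
    by (simp add: distrib_right exp_minus_inverse flip: exp_add mult.assoc of_real_mult)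
  finally have "\<omega> (c \<otimes> d) = 0 \<or> complex_of_real (exp (- ((a + b) * \<beta>))) = 1"
    by auto
  then show ?thesis using \<open>\<beta> \<noteq> 0\<close> \<open>a + b \<noteq> 0\<close> by simp
qed

lemma linear_map_mult_both:
  assumes "u \<in> carrier C" "v \<in> carrier C"
  shows "linear_map C C (\<lambda>y. u \<otimes> y \<otimes> v)"
  using assms
  by (auto simp: linear_map_def mult_closed distr_l distr_r smult_mult_l smult_mult_r)

text \<open>Serves to pull the closed core back under y -> u y v when the core is shown to be stable
  under such maps.\<close>

lemma continuous_map_mult_both:
  assumes "u \<in> carrier C" "v \<in> carrier C"
  shows "continuous_map ntop ntop (\<lambda>y. u \<otimes> y \<otimes> v)"
proof (rule continuous_map_bounded_linear)
  show "linear_map C C (\<lambda>y. u \<otimes> y \<otimes> v)"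
    using assms by (rule linear_map_mult_both)
  fix x assume x: "x \<in> carrier C"
  have "nrm C (u \<otimes> x \<otimes> v) \<le> nrm C (u \<otimes> x) * nrm C v"
    using assms x by (intro nrm_mult mult_closed)
  also have "\<dots> \<le> nrm C u * nrm C x * nrm C v"
    using assms x by (intro mult_right_mono nrm_mult nrm_nonneg)
  finally show "nrm C (u \<otimes> x \<otimes> v) \<le> nrm C u * nrm C v * nrm C x"
    by (simp add: mult_ac)
qed

end

theorem proposition3p3:
  fixes G :: "'g monoid" and P :: "'g set" and X :: "('g, 'x) prod_sys"
    and B :: "'b star_alg" and i :: "'g \<Rightarrow> 'x \<Rightarrow> 'b" and \<Phi> :: "'b \<Rightarrow> 'b"
    and N :: "'g \<Rightarrow> real" and \<sigma> :: "real \<Rightarrow> 'b \<Rightarrow> 'b" and \<beta> :: real and \<omega> :: "'b \<Rightarrow> complex"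
  assumes "quasi_lattice_ordered G P"
    and "product_system G P X"
    and "compactly_aligned G P X"
    and "nica_toeplitz_algebra G P X B i"
    and "core_expectation P X B i \<Phi>"
    and "N \<in> hom G positive_reals"
    and "inj_on N (carrier G)"
    and "dynamics_from G P X B i N \<sigma>"
    and "0 < \<beta>"
    and "KMS_state B \<sigma> \<beta> \<omega>"
  shows "let F = core P X B i; \<phi> = restrict \<omega> F in
    tracial_state (B\<lparr>carrier := F\<rparr>) \<phi>
    \<and> (\<forall>b\<in>carrier B. \<omega> b = \<phi> (\<Phi> b))
    \<and> (\<forall>s\<in>P. \<forall>\<xi>\<in>carrier (fib X s). \<forall>\<eta>\<in>carrier (fib X s). \<forall>y\<in>F.
          i s \<xi> \<otimes>\<^bsub>B\<^esub> y \<otimes>\<^bsub>B\<^esub> star B (i s \<eta>) \<in> F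
          \<and> \<phi> (i s \<xi> \<otimes>\<^bsub>B\<^esub> y \<otimes>\<^bsub>B\<^esub> star B (i s \<eta>))
              = complex_of_real (N s powr (- \<beta>)) * \<phi> (y \<otimes>\<^bsub>B\<^esub> i \<one>\<^bsub>G\<^esub> (ip (fib X s) \<eta> \<xi>)))
    \<and> (\<forall>s\<in>P. \<forall>r\<in>P. \<forall>\<xi>\<in>carrier (fib X s). \<forall>\<eta>\<in>carrier (fib X r). \<forall>y\<in>F.
          \<phi> (\<Phi> (i s \<xi> \<otimes>\<^bsub>B\<^esub> y \<otimes>\<^bsub>B\<^esub> star B (i r \<eta>)))
            = (if s = r
               then complex_of_real (N s powr (- \<beta>)) * \<phi> (y \<otimes>\<^bsub>B\<^esub> i \<one>\<^bsub>G\<^esub> (ip (fib X s) \<eta> \<xi>))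
               else 0))"
proof -
  define F where "F = core P X B i"
  interpret B: cstar_algebra B
    using assms(4) by (simp add: nica_toeplitz_algebra_def)
  interpret A: cstar_algebra "coeff X"
    using assms(2) by (simp add: product_system_def)
  note KMS = assms(10)
  have \<omega>: "state B \<omega>" using KMS by (simp add: KMS_state_def)
  have rep: "toeplitz_rep G P X B i"
    using assms(4) by (simp add: nica_toeplitz_algebra_def nica_covariant_def)
  have P: "P \<subseteq> carrier G" "\<And>s r. s \<in> P \<Longrightarrow> r \<in> P \<Longrightarrow> s \<otimes>\<^bsub>G\<^esub> r \<in> P" "\<one>\<^bsub>G\<^esub> \<in> P"
    using assms(1) by (auto simp: quasi_lattice_ordered_def)

  \<comment> \<open>Relations of the universal representation\<close>
  have i_closed [simp]: "i s \<xi> \<in> carrier B" if "s \<in> P" "\<xi> \<in> carrier (fib X s)" for s \<xi>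
    using rep that by (auto simp: toeplitz_rep_def linear_map_def)
  have i_mult: "i s \<xi> \<otimes>\<^bsub>B\<^esub> i r \<eta> = i (s \<otimes>\<^bsub>G\<^esub> r) (pmul X s r \<xi> \<eta>)"
    "pmul X s r \<xi> \<eta> \<in> carrier (fib X (s \<otimes>\<^bsub>G\<^esub> r))"
    if "s \<in> P" "r \<in> P" "\<xi> \<in> carrier (fib X s)" "\<eta> \<in> carrier (fib X r)" for s r \<xi> \<eta>
    using rep assms(2) that by (auto simp: toeplitz_rep_def product_system_def)
  have i_ip: "star B (i s \<eta>) \<otimes>\<^bsub>B\<^esub> i s \<xi> = i \<one>\<^bsub>G\<^esub> (ip (fib X s) \<eta> \<xi>)"
    if "s \<in> P" "\<xi> \<in> carrier (fib X s)" "\<eta> \<in> carrier (fib X s)" for s \<xi> \<eta>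
    using rep that by (auto simp: toeplitz_rep_def)
  have ip_closed: "ip (fib X s) \<eta> \<xi> \<in> carrier (coeff X)"
    if "s \<in> P" "\<xi> \<in> carrier (fib X s)" "\<eta> \<in> carrier (fib X s)" for s \<xi> \<eta>
    using assms(2) that
    by (auto simp: product_system_def hilbert_bimodule_def right_hilbert_module.ip_closed)
  have fib_one: "carrier (fib X \<one>\<^bsub>G\<^esub>) = carrier (coeff X)"
    using assms(2) by (simp add: product_system_def self_bimod_def)
  note [simp] = B.mult_closed B.star_closed

  \<comment> \<open>The core and the expectation onto it\<close>
  have cond: "conditional_expectation B F \<Phi>"
    using assms(5) by (simp add: core_expectation_def F_def)
  have F_sub: "submodule F complex_field B"
    and F_mult: "\<And>x y. x \<in> F \<Longrightarrow> y \<in> F \<Longrightarrow> x \<otimes>\<^bsub>B\<^esub> y \<in> F"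
    and F_star: "\<And>x. x \<in> F \<Longrightarrow> star B x \<in> F"
    and F_closed: "closedin B.ntop F"
    using cond by (auto simp: conditional_expectation_def cstar_subalgebra_def)
  note F = B.V.submoduleE[OF F_sub, simplified]
  have F_carrier [simp]: "x \<in> carrier B" if "x \<in> F" for x
    using F(1) that by auto
  have \<Phi>_F: "\<Phi> x \<in> F" if "x \<in> carrier B" for x
    using cond that by (auto simp: conditional_expectation_def linear_map_def)
  \<comment> \<open>\<open>\<Phi>\<close> is regarded as a map into all of \<open>B\<close>, the
    form that the continuity lemma for bounded linear maps expects.\<close>
  have \<Phi>_lin: "linear_map B B \<Phi>"
    using cond \<Phi>_F by (auto simp: conditional_expectation_def linear_map_def)
  have \<Phi>_nrm: "nrm B (\<Phi> x) \<le> nrm B x" if "x \<in> carrier B" for x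
    using cond that by (auto simp: conditional_expectation_def)
  have \<Phi>_id: "\<Phi> x = x" if "x \<in> F" for x
    using cond that by (auto simp: conditional_expectation_def)
  have F_gen: "i s \<xi> \<otimes>\<^bsub>B\<^esub> star B (i s \<eta>) \<in> F"
    if "s \<in> P" "\<xi> \<in> carrier (fib X s)" "\<eta> \<in> carrier (fib X s)" for s \<xi> \<eta>
  proof -
    have "{i s \<xi> \<otimes>\<^bsub>B\<^esub> star B (i s \<eta>) | s \<xi> \<eta>.
        s \<in> P \<and> \<xi> \<in> carrier (fib X s) \<and> \<eta> \<in> carrier (fib X s)} \<subseteq> F"
      unfolding F_def core_def by (rule B.closed_span_superset) auto
    with that show ?thesis by blast
  qed

  \<comment> \<open>The unit of A lets i_e(a) be written as i_e(a) times the adjoint of i_e(1),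
    which is a generator of the core in degree e.\<close>
  have i_one_F: "i \<one>\<^bsub>G\<^esub> a \<in> F" if a: "a \<in> carrier (coeff X)" for a
  proof -
    let ?e = "\<one>\<^bsub>coeff X\<^esub>"
    have e: "?e \<in> carrier (coeff X)" "?e \<otimes>\<^bsub>coeff X\<^esub> star (coeff X) a = star (coeff X) a"
      using assms(2) a by (auto simp: product_system_def unital_def A.star_closed)
    then have "a \<otimes>\<^bsub>coeff X\<^esub> star (coeff X) ?e = a"
      using A.star_mult[of ?e "star (coeff X) a"] a by (simp add: A.star_star A.star_closed)
    moreover have "star_hom (coeff X) B (i \<one>\<^bsub>G\<^esub>)"
      using rep by (simp add: toeplitz_rep_def)
    ultimately have "i \<one>\<^bsub>G\<^esub> a = i \<one>\<^bsub>G\<^esub> a \<otimes>\<^bsub>B\<^esub> star B (i \<one>\<^bsub>G\<^esub> ?e)"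
      using a e A.star_closed unfolding star_hom_def by metis
    then show ?thesis
      using F_gen[of "\<one>\<^bsub>G\<^esub>" a ?e] P a e by (simp add: fib_one)
  qed

  \<comment> \<open>Eigenvectors and fixed points of the dynamics\<close>
  have N_pos: "0 < N s" if "s \<in> P" for s
    using assms(6) P that by (auto simp: hom_def positive_reals_def)
  have \<sigma>_hom: "star_hom B B (\<sigma> t)" and \<sigma>_nrm: "\<And>x. x \<in> carrier B \<Longrightarrow> nrm B (\<sigma> t x) = nrm B x" for t
    using assms(8) by (auto simp: dynamics_from_def dynamics_def star_automorphism_def)
  have \<sigma>_lin: "linear_map B B (\<sigma> t)"
    and \<sigma>_mult: "\<And>x y. x \<in> carrier B \<Longrightarrow> y \<in> carrier B \<Longrightarrow> \<sigma> t (x \<otimes>\<^bsub>B\<^esub> y) = \<sigma> t x \<otimes>\<^bsub>B\<^esub> \<sigma> t y"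
    and \<sigma>_star: "\<And>x. x \<in> carrier B \<Longrightarrow> \<sigma> t (star B x) = star B (\<sigma> t x)" for t
    using \<sigma>_hom[of t] by (auto simp: star_hom_def)
  have \<sigma>_i: "\<sigma> t (i s \<xi>) = exp (\<i> * complex_of_real (ln (N s) * t)) \<odot>\<^bsub>B\<^esub> i s \<xi>"
    if "s \<in> P" "\<xi> \<in> carrier (fib X s)" for s \<xi> t
  proof -
    \<comment> \<open>The principal logarithm of a positive number is real, so the phase takes the
      form exp(iat) with a = ln N(s).\<close>
    have "complex_of_real (N s) powr (\<i> * complex_of_real t) = exp (\<i> * complex_of_real (ln (N s) * t))"
      using N_pos[OF that(1)] by (simp add: powr_def Ln_of_real mult_ac)
    then show ?thesis
      using assms(8) that by (simp add: dynamics_from_def)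
  qed
  have \<sigma>_i_star: "\<sigma> t (star B (i s \<xi>)) = exp (\<i> * complex_of_real (- ln (N s) * t)) \<odot>\<^bsub>B\<^esub> star B (i s \<xi>)"
    if "s \<in> P" "\<xi> \<in> carrier (fib X s)" for s \<xi> t
    using that by (simp add: \<sigma>_star \<sigma>_i B.star_smult exp_cnj)
  \<comment> \<open>On a generator the two eigenvalues cancel; the fixed points form a closed set
    because \<open>\<sigma> t\<close> is isometric and the topology is Hausdorff.\<close>
  have \<sigma>_F: "\<sigma> t y = y" if "y \<in> F" for y t
    using that unfolding F_def core_def
  proof (induction rule: B.closed_span_induct)
    case closed
    have "continuous_map B.ntop B.ntop (\<sigma> t)"
      by (rule B.continuous_map_bounded_linear[of _ 1]) (simp_all add: \<sigma>_lin \<sigma>_nrm)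
    then show ?case
      using closedin_continuous_maps_eq[OF B.Hausdorff_ntop, of B.ntop "\<sigma> t" "\<lambda>x. x"] by simp
  next
    case zero
    show ?case by (rule B.linear_map_zero[OF \<sigma>_lin])
  next
    case (base x)
    then show ?case
      by (auto simp: \<sigma>_mult \<sigma>_i \<sigma>_i_star B.smult_mult_l B.smult_mult_r B.smult_smult
          simp flip: exp_add)
  qed (simp_all add: B.linear_mapD[OF \<sigma>_lin])
  have \<sigma>_i_F: "\<sigma> t (i s \<xi> \<otimes>\<^bsub>B\<^esub> y) = exp (\<i> * complex_of_real (ln (N s) * t)) \<odot>\<^bsub>B\<^esub> (i s \<xi> \<otimes>\<^bsub>B\<^esub> y)"
    if "s \<in> P" "\<xi> \<in> carrier (fib X s)" "y \<in> F" for s \<xi> y t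
    using that by (simp add: \<sigma>_mult \<sigma>_i \<sigma>_F B.smult_mult_l)

  \<comment> \<open>Trace property and factorization through the expectation\<close>
  have trace: "\<omega> (x \<otimes>\<^bsub>B\<^esub> y) = \<omega> (y \<otimes>\<^bsub>B\<^esub> x)" if "x \<in> F" "y \<in> F" for x y
    \<comment> \<open>Elements of the core have exponent 0, so the KMS factor is exp(0) = 1.\<close>
    using B.KMS_eigenvector[OF KMS, of x 0 y 0] that by (simp add: \<sigma>_F)
  \<comment> \<open>This is the sum of the exponents of i_s(\<xi>) and the adjoint of i_r(\<eta>),
    nonzero because \<open>N\<close> and the logarithm are injective.\<close>
  have ln_N: "ln (N s) + - ln (N r) \<noteq> 0" if "s \<in> P" "r \<in> P" "s \<noteq> r" for s r
    using that assms(7) N_pos P(1) by (auto simp: inj_on_def)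

  have \<omega>_\<Phi>: "\<omega> b = \<omega> (\<Phi> b)" if "b \<in> carrier B" for b
  proof -
    have "b \<in> closed_span B {i s \<xi> \<otimes>\<^bsub>B\<^esub> star B (i r \<eta>) | s r \<xi> \<eta>.
             s \<in> P \<and> r \<in> P \<and> \<xi> \<in> carrier (fib X s) \<and> \<eta> \<in> carrier (fib X r)}"
      using that assms(4) by (simp add: nica_toeplitz_algebra_def)
    then show ?thesis
    proof (induction rule: B.closed_span_induct)
      case closed
      have "continuous_map B.ntop B.ntop \<Phi>"
        by (rule B.continuous_map_bounded_linear[of _ 1]) (simp_all add: \<Phi>_lin \<Phi>_nrm)
      then have "continuous_map B.ntop euclidean (\<omega> \<circ> \<Phi>)"
        using B.continuous_map_state[OF \<omega>] by (rule continuous_map_compose)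
      then show ?case
        using closedin_continuous_maps_eq[OF _ B.continuous_map_state[OF \<omega>], of "\<omega> \<circ> \<Phi>"] by simp
    next
      case zero
      show ?case by (simp add: B.linear_map_zero[OF \<Phi>_lin])
    next
      case (base x)
      then obtain s r \<xi> \<eta> where x: "x = i s \<xi> \<otimes>\<^bsub>B\<^esub> star B (i r \<eta>)"
        and sr: "s \<in> P" "r \<in> P" "\<xi> \<in> carrier (fib X s)" "\<eta> \<in> carrier (fib X r)" by blast
      have "\<omega> x = \<omega> (\<Phi> x)"
      \<comment> \<open>For s = r the monomial lies in the core and is fixed by
        \<open>\<Phi>\<close>; otherwise both sides vanish.\<close>
      proof (cases "s = r")
        case True
        then show ?thesis using sr x F_gen \<Phi>_id by simp
      next
        case False
        then have "\<Phi> x = \<zero>\<^bsub>B\<^esub>"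
          using assms(5) sr by (simp add: core_expectation_def x)
        moreover have "\<omega> x = 0"
          using B.KMS_eigenvector_mult_eq_0[OF KMS _ _ \<sigma>_i _ \<sigma>_i_star ln_N] assms(9) sr False
          by (simp add: x)
        \<comment> \<open>The state bound at the zero vector yields \<omega>(0) = 0.\<close>
        ultimately show ?thesis
          using B.state_bound[OF \<omega>, of "\<zero>\<^bsub>B\<^esub>"] B.nrm_eq_0[of "\<zero>\<^bsub>B\<^esub>"] by simp
      qed
      with sr show ?case by (simp add: x)
    qed (use \<omega> B.linear_mapD[OF \<Phi>_lin] in \<open>auto simp: state_def\<close>)
  qed

  \<comment> \<open>Conjugation of the core and the scaling identity\<close>
  have conj_F: "i s \<xi> \<otimes>\<^bsub>B\<^esub> y \<otimes>\<^bsub>B\<^esub> star B (i s \<eta>) \<in> F"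
    if s: "s \<in> P" "\<xi> \<in> carrier (fib X s)" "\<eta> \<in> carrier (fib X s)" and "y \<in> F" for s \<xi> \<eta> y
    using \<open>y \<in> F\<close>[unfolded F_def core_def]
  proof (induction rule: B.closed_span_induct)
    case closed
    show ?case
      using closedin_continuous_map_preimage[OF B.continuous_map_mult_both F_closed] s by simp
  next
    case zero
    \<comment> \<open>Zero is obtained as 0 times the given core element \<open>y\<close>.\<close>
    have "\<zero>\<^bsub>B\<^esub> \<in> F"
      using \<open>y \<in> F\<close> F(4)[of y 0] by simp
    then show ?case
      using B.linear_map_zero[OF B.linear_map_mult_both] s by simp
  next
    case (add x y)
    then show ?case using s F(5) by (simp add: B.distr_l B.distr_r)
  next
    case (smult c x)
    then show ?case using s F(4) by (simp add: B.smult_mult_l B.smult_mult_r)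
  next
    case (base x)
    then obtain r \<xi>' \<eta>' where x: "x = i r \<xi>' \<otimes>\<^bsub>B\<^esub> star B (i r \<eta>')"
      and r: "r \<in> P" "\<xi>' \<in> carrier (fib X r)" "\<eta>' \<in> carrier (fib X r)" by blast
    \<comment> \<open>Regrouping and multiplicativity turn the conjugate of a degree-r generator
      into a generator in degree sr.\<close>
    have "i s \<xi> \<otimes>\<^bsub>B\<^esub> x \<otimes>\<^bsub>B\<^esub> star B (i s \<eta>)
        = (i s \<xi> \<otimes>\<^bsub>B\<^esub> i r \<xi>') \<otimes>\<^bsub>B\<^esub> star B (i s \<eta> \<otimes>\<^bsub>B\<^esub> i r \<eta>')"
      using s r by (simp add: x B.star_mult B.mult_assoc)
    then show ?case using s r P(2) F_gen by (simp add: x i_mult)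
  qed

  have scale: "\<omega> (i s \<xi> \<otimes>\<^bsub>B\<^esub> y \<otimes>\<^bsub>B\<^esub> star B (i r \<eta>))
      = (if s = r then complex_of_real (N s powr (- \<beta>)) * \<omega> (y \<otimes>\<^bsub>B\<^esub> i \<one>\<^bsub>G\<^esub> (ip (fib X s) \<eta> \<xi>)) else 0)"
    if s: "s \<in> P" "r \<in> P" "\<xi> \<in> carrier (fib X s)" "\<eta> \<in> carrier (fib X r)" "y \<in> F" for s r \<xi> \<eta> y
  proof (cases "s = r")
    case True
    \<comment> \<open>Commuting i_s(\<xi>)y past the adjoint of i_s(\<eta>) puts the inner product
      to the left of \<open>y\<close>; the trace property then moves it to the right.\<close>
    have "\<omega> (i s \<xi> \<otimes>\<^bsub>B\<^esub> y \<otimes>\<^bsub>B\<^esub> star B (i s \<eta>))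
        = exp (- (ln (N s) * \<beta>)) * \<omega> (star B (i s \<eta>) \<otimes>\<^bsub>B\<^esub> (i s \<xi> \<otimes>\<^bsub>B\<^esub> y))"
      using s True by (intro B.KMS_eigenvector[OF KMS _ \<sigma>_i_F _ \<sigma>_i_star]) auto
    also have "star B (i s \<eta>) \<otimes>\<^bsub>B\<^esub> (i s \<xi> \<otimes>\<^bsub>B\<^esub> y) = i \<one>\<^bsub>G\<^esub> (ip (fib X s) \<eta> \<xi>) \<otimes>\<^bsub>B\<^esub> y"
      using s True i_ip by (simp flip: B.mult_assoc)
    also have "\<omega> \<dots> = \<omega> (y \<otimes>\<^bsub>B\<^esub> i \<one>\<^bsub>G\<^esub> (ip (fib X s) \<eta> \<xi>))"
      using s True by (intro trace i_one_F ip_closed) auto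
    finally show ?thesis
      using N_pos[OF s(1)] True by (simp add: powr_def mult.commute)
  next
    case False
    then show ?thesis
      using B.KMS_eigenvector_mult_eq_0[OF KMS _ _ \<sigma>_i_F _ \<sigma>_i_star ln_N] assms(9) s by simp
  qed

  (* \<Phi> is contractive and preserves \<omega>, so restricting \<omega> to the core does not lower its norm. *)
  have "(\<lambda>x. cmod (restrict \<omega> F x)) ` {x \<in> F. nrm B x \<le> 1}
      = (\<lambda>x. cmod (\<omega> x)) ` {x \<in> carrier B. nrm B x \<le> 1}"
  proof (intro equalityI subsetI; elim imageE; clarify)
    fix x assume "x \<in> carrier B" "nrm B x \<le> 1"
    then show "cmod (\<omega> x) \<in> (\<lambda>x. cmod (restrict \<omega> F x)) ` {x \<in> F. nrm B x \<le> 1}"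
      using \<omega>_\<Phi>[of x] \<Phi>_F[of x] \<Phi>_nrm[of x] by (intro image_eqI[of _ _ "\<Phi> x"]) auto
  qed auto
  \<comment> \<open>Products and adjoints of core elements stay in the core, so positivity is
    inherited from \<open>B\<close>; the equality of images gives norm one.\<close>
  then have "state (B\<lparr>carrier := F\<rparr>) (restrict \<omega> F)"
    using \<omega> F(4,5) F_mult F_star by (simp add: state_def)
  then have "tracial_state (B\<lparr>carrier := F\<rparr>) (restrict \<omega> F)"
    using F_mult trace by (simp add: tracial_state_def)
  \<comment> \<open>Since \<omega> = \<omega> \<circ> \<Phi>, the identity stated through
    \<open>\<Phi>\<close> is the scaling identity already proved for \<omega> itself.\<close>
  then show ?thesis
    unfolding Let_def F_def[symmetric]
    using \<omega>_\<Phi> \<Phi>_F conj_F scale F_mult i_one_F ip_closed by (auto simp flip: \<omega>_\<Phi>)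
qed

end
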